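(* Let $X$ be a type with distinguished element $0_X$, let $R$ be a type, let $q\colon X^{\mathbb{N}}\to R$, $\omega\colon X^{\mathbb{N}}\to\mathbb{N}$, and let $(\varepsilon_s)_{s\in X^\ast}$ be selection functions $\varepsilon_s\colon (X\to R)\to X$. Let $(\mathrm{EPS}_s)_{s\in X^\ast}$, with $\mathrm{EPS}_s\colon (X^{\mathbb{N}}\to R)\to X^{\mathbb{N}}$, be the explicitly controlled unbounded product of the $\varepsilon_s$ with control $\omega$, i.e. a family satisfying, for all $s\in X^\ast$ and all $r\colon X^{\mathbb{N}}\to R$, $$\mathrm{EPS}_s(r)=\begin{cases}\mathbf{0} & \text{if } \omega(\hat s)<|s|,\\ a_s\ast \mathrm{EPS}_{s\ast a_s}(r_{a_s}) & \text{otherwise},\end{cases}\qquad a_s=\varepsilon_s\big(\lambda x.\, r(x\ast \mathrm{EPS}_{s\ast x}(r_x))\big).$$ Define $\alpha=\mathrm{EPS}_{\langle\rangle}(q)$ and, for $s\in X^\ast$ and $x\in X$, $p_s(x)=q_{s\ast x}\big(\mathrm{EPS}_{s\ast x}(q_{s\ast x})\big)$. Then for every $n\le\omega(\alpha)$, $$\alpha(n)=\varepsilon_{[\alpha](n)}\big(p_{[\alpha](n)}\big)\quad\text{and}\quad q(\alpha)=p_{[\alpha](n)}\Big(\varepsilon_{[\alpha](n)}\big(p_{[\alpha](n)}\big)\Big).$$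
   Context: $X^\ast$ is the type of finite sequences over $X$, $X^{\mathbb{N}}$ of infinite sequences. $s\ast t$ denotes concatenation, $|s|$ is the length of $s$, $\mathbf{0}$ is the constant sequence $0_X,0_X,\dots$, $\hat s=s\ast\mathbf{0}$, $[\alpha](n)=\langle\alpha(0),\dots,\alpha(n-1)\rangle$, and for a finite sequence (or element) $a$, $r_a(\beta)=r(a\ast\beta)$. All functions are extensional. *)

theory Defs
  imports "HOL-Library.Omega_Words_Fun"
begin

text \<open>Infinite sequences over \<open>'x\<close> are functions \<open>nat \<Rightarrow> 'x\<close>; the concatenation \<open>s \<frown> \<beta>\<close> and the
  initial segment \<open>prefix n \<alpha>\<close> are those of \<open>HOL-Library.Omega_Words_Fun\<close>.\<close>

text \<open>The outcome function \<open>r\<^sub>s\<close>; an element \<open>x\<close> is treated as the list \<open>[x]\<close>.\<close>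

definition after :: "((nat \<Rightarrow> 'x) \<Rightarrow> 'r) \<Rightarrow> 'x list \<Rightarrow> (nat \<Rightarrow> 'x) \<Rightarrow> 'r" where
  "after r s = (\<lambda>\<beta>. r (s \<frown> \<beta>))"

definition extend0 :: "'x \<Rightarrow> 'x list \<Rightarrow> nat \<Rightarrow> 'x" where
  "extend0 z s = s \<frown> (\<lambda>_. z)"

text \<open>The equation for \<open>EPS\<close> is not a terminating recursion for arbitrary \<open>\<omega>\<close>, so the product is
  characterised as a family solving it rather than defined as a function.\<close>

definition is_EPS ::
  "'x \<Rightarrow> ((nat \<Rightarrow> 'x) \<Rightarrow> nat) \<Rightarrow> ('x list \<Rightarrow> ('x \<Rightarrow> 'r) \<Rightarrow> 'x)
    \<Rightarrow> ('x list \<Rightarrow> ((nat \<Rightarrow> 'x) \<Rightarrow> 'r) \<Rightarrow> nat \<Rightarrow> 'x) \<Rightarrow> bool" where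
  "is_EPS z \<omega> \<epsilon> EPS \<longleftrightarrow>
    (\<forall>s r. EPS s r =
      (if \<omega> (extend0 z s) < length s then (\<lambda>_. z)
       else let a = \<epsilon> s (\<lambda>x. after r [x] (EPS (s @ [x]) (after r [x])))
            in [a] \<frown> EPS (s @ [a]) (after r [a])))"

end

(* Along the play, \<alpha> = s \<frown> EPS s (q_s) for every initial segment s of \<alpha> of length at most
   \<omega> \<alpha> + 1. The product cannot stop at such an s with length s \<le> \<omega> \<alpha>: stopping would give
   \<alpha> = s \<frown> 0, so the stopping condition \<omega> (s \<frown> 0) < length s would say \<omega> \<alpha> < length s. No
   continuity of \<omega> is needed. *)

theory Submission
  imports Defs
begin

lemma after_after: "after (after r s) t = after r (s @ t)"
  by (simp add: after_def)

text \<open>One move of the play: the decomposition of \<open>\<alpha>\<close> at \<open>s\<close>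
  passes to \<open>s @ [a]\<close>, where \<open>a\<close> is defined by the selection function and
  not as the next entry of \<open>\<alpha>\<close>.\<close>

lemma EPS_unfold_along_play:
  fixes q :: "(nat \<Rightarrow> 'x) \<Rightarrow> 'r"
  assumes EPS: "is_EPS z \<omega> \<epsilon> EPS"
    and \<alpha>: "\<alpha> = s \<frown> EPS s (after q s)"
    and le: "length s \<le> \<omega> \<alpha>"
    and a: "a = \<epsilon> s (\<lambda>x. after q (s @ [x]) (EPS (s @ [x]) (after q (s @ [x]))))"
  shows "\<alpha> = (s @ [a]) \<frown> EPS (s @ [a]) (after q (s @ [a]))"
proof -
  have eq: "EPS s (after q s) =
    (if \<omega> (extend0 z s) < length s then (\<lambda>_. z)
     else [a] \<frown> EPS (s @ [a]) (after q (s @ [a])))"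
    using EPS[unfolded is_EPS_def, rule_format, of s "after q s"]
    unfolding after_after Let_def a .
  have "\<not> \<omega> (extend0 z s) < length s"
  proof
    assume stop: "\<omega> (extend0 z s) < length s"
    with eq \<alpha> have "\<alpha> = extend0 z s"
      by (simp add: extend0_def)
    with stop le show False by simp
  qed
  with eq \<alpha> show ?thesis by simp
qed

theorem theorem2p6:
  fixes z :: 'x
    and q :: "(nat \<Rightarrow> 'x) \<Rightarrow> 'r"
    and \<omega> :: "(nat \<Rightarrow> 'x) \<Rightarrow> nat"
    and \<epsilon> :: "'x list \<Rightarrow> ('x \<Rightarrow> 'r) \<Rightarrow> 'x"
    and EPS :: "'x list \<Rightarrow> ((nat \<Rightarrow> 'x) \<Rightarrow> 'r) \<Rightarrow> nat \<Rightarrow> 'x"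
    and \<alpha> :: "nat \<Rightarrow> 'x"
    and p :: "'x list \<Rightarrow> 'x \<Rightarrow> 'r"
  assumes EPS: "is_EPS z \<omega> \<epsilon> EPS"
    and \<alpha>: "\<alpha> = EPS [] q"
    and p: "\<And>s x. p s x = after q (s @ [x]) (EPS (s @ [x]) (after q (s @ [x])))"
  shows "\<forall>n \<le> \<omega> \<alpha>. \<alpha> n = \<epsilon> (prefix n \<alpha>) (p (prefix n \<alpha>)) \<and>
    q \<alpha> = p (prefix n \<alpha>) (\<epsilon> (prefix n \<alpha>) (p (prefix n \<alpha>)))"
proof -
  have step: "\<alpha> = (s @ [\<epsilon> s (p s)]) \<frown> EPS (s @ [\<epsilon> s (p s)]) (after q (s @ [\<epsilon> s (p s)]))"
    if "\<alpha> = s \<frown> EPS s (after q s)" "length s \<le> \<omega> \<alpha>" for s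
    using EPS_unfold_along_play[OF EPS that refl] unfolding p[symmetric] .
  \<comment> \<open>The decomposition at \<open>n\<close> is a premise here because the induction
    for \<open>inv\<close> uses this fact to recognise the selected move as
    \<open>\<alpha> n\<close>.\<close>
  have nth: "\<alpha> n = \<epsilon> (prefix n \<alpha>) (p (prefix n \<alpha>))"
    if inv: "\<alpha> = prefix n \<alpha> \<frown> EPS (prefix n \<alpha>) (after q (prefix n \<alpha>))"
      and le: "n \<le> \<omega> \<alpha>" for n
  proof -
    define s where "s = prefix n \<alpha>"
    have "\<alpha> = (s @ [\<epsilon> s (p s)]) \<frown> EPS (s @ [\<epsilon> s (p s)]) (after q (s @ [\<epsilon> s (p s)]))"
      by (rule step) (use inv le in \<open>simp_all add: s_def\<close>)
    \<comment> \<open>As \<open>s\<close> has length \<open>n\<close>, position \<open>n\<close> on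
      the right holds the appended move.\<close>
    from fun_cong[OF this, of n] show ?thesis
      by (simp add: conc_def nth_append s_def)
  qed
  have inv: "\<alpha> = prefix n \<alpha> \<frown> EPS (prefix n \<alpha>) (after q (prefix n \<alpha>))"
    \<comment> \<open>The bound exceeds \<open>\<omega> \<alpha>\<close> by one since the claim on
      \<open>q \<alpha>\<close> at \<open>n = \<omega> \<alpha>\<close> needs the decomposition
      after move \<open>n\<close>.\<close>
    if "n \<le> Suc (\<omega> \<alpha>)" for n
    using that
  proof (induction n)
    case 0
    show ?case by (simp add: \<alpha> after_def)
  next
    case (Suc n)
    then have IH: "\<alpha> = prefix n \<alpha> \<frown> EPS (prefix n \<alpha>) (after q (prefix n \<alpha>))"
      and le: "n \<le> \<omega> \<alpha>" by simp_all
    have "prefix (Suc n) \<alpha> = prefix n \<alpha> @ [\<alpha> n]" by simp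
    with step[OF IH] le nth[OF IH le] show ?case by simp
  qed
  show ?thesis
  proof (intro allI impI conjI)
    fix n assume n: "n \<le> \<omega> \<alpha>"
    then show eq: "\<alpha> n = \<epsilon> (prefix n \<alpha>) (p (prefix n \<alpha>))"
      by (intro nth inv) simp_all
    have "\<alpha> = (prefix n \<alpha> @ [\<alpha> n]) \<frown>
        EPS (prefix n \<alpha> @ [\<alpha> n]) (after q (prefix n \<alpha> @ [\<alpha> n]))"
      using inv[of "Suc n"] n by simp
    \<comment> \<open>The right side unfolds to \<open>q\<close> of the decomposition just
      obtained.\<close>
    then have "q \<alpha> = p (prefix n \<alpha>) (\<alpha> n)"
      unfolding p after_def[of q "prefix n \<alpha> @ [\<alpha> n]"] by (rule arg_cong)
    then show "q \<alpha> = p (prefix n \<alpha>) (\<epsilon> (prefix n \<alpha>) (p (prefix n \<alpha>)))"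
      unfolding eq .
  qed
qed

end
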